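(* Let $R$ be a commutative ring, let $n\in\mathbb{N}$, and let $A$ be a $1$-nullcyclic $n\times n$-matrix over $R$. Then $A^m$ is (well-defined and) $1$-nullcyclic for every integer $m\in\mathbb{Z}$.
   Context: All rings are commutative, associative and unital; $\mathbb{N}=\{0,1,2,\ldots\}$ and $[n]:=\{1,2,\ldots,n\}$. A cycle on $[n]$ is a $k$-tuple $C=(i_1,i_2,\ldots,i_k)$ with $k>0$ and $i_1,\ldots,i_k$ distinct elements of $[n]$, considered up to cyclic rotation; it is nontrivial if $k>1$. For a matrix $A=(a_{i,j})_{i,j\in[n]}$ over $R$, the $A$-weight of a cycle $C=(i_1,\ldots,i_k)$ is $w_A(C):=a_{i_1,i_2}a_{i_2,i_3}\cdots a_{i_{k-1},i_k}a_{i_k,i_1}$. The matrix $A$ is nullcyclic if $w_A(C)=0$ for each nontrivial cycle $C$ on $[n]$; it is $1$-diagonal if all its diagonal entries $a_{i,i}$ equal $1$; it is $1$-nullcyclic if it is both $1$-diagonal and nullcyclic. (A $1$-nullcyclic matrix is invertible, which is part of what makes negative powers meaningful.) *)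

theory Defs
  imports "Jordan_Normal_Form.Matrix" "HOL-Algebra.Group"
begin

(* Entries have sort {comm_ring, comm_monoid_mult}: a commutative ring with unit.
   This is comm_ring_1 without the axiom 0 ~= 1, so that the zero ring is included. *)

(* A cycle is represented by any tuple (list) in its rotation class; cycle_weight_rotate1
   below shows that the weight does not depend on the choice of the tuple.
   The index set [n] is rendered as {..<n}, the row and column indices of an n x n matrix. *)
definition cycle_on :: "nat \<Rightarrow> nat list \<Rightarrow> bool" where
  "cycle_on n c \<longleftrightarrow> length c > 0 \<and> distinct c \<and> set c \<subseteq> {..<n}"

definition nontrivial_cycle_on :: "nat \<Rightarrow> nat list \<Rightarrow> bool" where
  "nontrivial_cycle_on n c \<longleftrightarrow> cycle_on n c \<and> length c > 1"

definition cycle_weight :: "'a::{comm_ring, comm_monoid_mult} mat \<Rightarrow> nat list \<Rightarrow> 'a" where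
  "cycle_weight A c = (\<Prod>j<length c. A $$ (c ! j, c ! (Suc j mod length c)))"

definition nullcyclic :: "nat \<Rightarrow> 'a::{comm_ring, comm_monoid_mult} mat \<Rightarrow> bool" where
  "nullcyclic n A \<longleftrightarrow> (\<forall>c. nontrivial_cycle_on n c \<longrightarrow> cycle_weight A c = 0)"

definition one_diagonal :: "nat \<Rightarrow> 'a::{comm_ring, comm_monoid_mult} mat \<Rightarrow> bool" where
  "one_diagonal n A \<longleftrightarrow> (\<forall>i<n. A $$ (i, i) = 1)"

definition one_nullcyclic :: "nat \<Rightarrow> 'a::{comm_ring, comm_monoid_mult} mat \<Rightarrow> bool" where
  "one_nullcyclic n A \<longleftrightarrow> A \<in> carrier_mat n n \<and> one_diagonal n A \<and> nullcyclic n A"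

(* The multiplicative monoid of n x n matrices. The integer power A [^] m of HOL-Algebra in this
   monoid is the usual one: a product of m copies of A for m >= 0 and the two-sided inverse of
   A [^] (-m) for m < 0. For m < 0 it is meaningful only if A is a unit of the monoid. *)
definition mat_monoid :: "'a::{comm_ring, comm_monoid_mult} itself \<Rightarrow> nat \<Rightarrow> 'a mat monoid" where
  "mat_monoid ty n = \<lparr>carrier = carrier_mat n n, mult = (*), one = 1\<^sub>m n\<rparr>"

lemma cycle_weight_rotate1:
  fixes A :: "'a::{comm_ring, comm_monoid_mult} mat"
  shows "cycle_weight A (rotate1 c) = cycle_weight A c"
proof (cases "c = []")
  case True
  then show ?thesis by simp
next
  case False
  let ?k = "length c"
  let ?f = "\<lambda>j. A $$ (c ! j, c ! (Suc j mod ?k))"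
  have k: "0 < ?k" using False by simp
  have "cycle_weight A (rotate1 c) = (\<Prod>j<?k. ?f (Suc j mod ?k))"
    using k unfolding cycle_weight_def by (auto intro!: prod.cong simp: nth_rotate1)
  also have "\<dots> = (\<Prod>j<?k. ?f j)"
  proof (rule prod.reindex_bij_betw)
    have inj: "inj_on (\<lambda>j. Suc j mod ?k) {..<?k}"
      by (auto intro!: inj_onI simp: mod_Suc split: if_splits)
    have "(\<lambda>j. Suc j mod ?k) ` {..<?k} \<subseteq> {..<?k}" using k by auto
    then show "bij_betw (\<lambda>j. Suc j mod ?k) {..<?k} {..<?k}"
      using inj by (simp add: bij_betw_def endo_inj_surj)
  qed
  finally show ?thesis by (simp add: cycle_weight_def)
qed

lemma monoid_mat_monoid:
  "monoid (mat_monoid TYPE('a::{comm_ring, comm_monoid_mult}) n)"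
proof -
  have l: "1\<^sub>m n * A = A" if A: "A \<in> carrier_mat n n" for A :: "'a mat"
  proof (rule eq_matI)
    fix i j assume "i < dim_row A" "j < dim_col A"
    with A have ij: "i < n" "j < n" by auto
    have "(1\<^sub>m n * A) $$ (i, j) = (\<Sum>k\<in>{0..<n}. (if i = k then 1 else 0) * A $$ (k, j))"
      using A ij by (auto simp: scalar_prod_def intro!: sum.cong)
    also have "\<dots> = (\<Sum>k\<in>{0..<n}. if i = k then A $$ (k, j) else 0)"
      by (rule sum.cong) auto
    finally show "(1\<^sub>m n * A) $$ (i, j) = A $$ (i, j)" using ij by (simp add: sum.delta')
  qed (use A in auto)
  have r: "A * 1\<^sub>m n = A" if A: "A \<in> carrier_mat n n" for A :: "'a mat"
  proof (rule eq_matI)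
    fix i j assume "i < dim_row A" "j < dim_col A"
    with A have ij: "i < n" "j < n" by auto
    have "(A * 1\<^sub>m n) $$ (i, j) = (\<Sum>k\<in>{0..<n}. A $$ (i, k) * (if k = j then 1 else 0))"
      using A ij by (auto simp: scalar_prod_def intro!: sum.cong)
    also have "\<dots> = (\<Sum>k\<in>{0..<n}. if k = j then A $$ (i, k) else 0)"
      by (rule sum.cong) auto
    finally show "(A * 1\<^sub>m n) $$ (i, j) = A $$ (i, j)" using ij by (simp add: sum.delta)
  qed (use A in auto)
  show ?thesis
    by (rule monoidI) (auto simp: mat_monoid_def l r intro: assoc_mult_mat)
qed

end

theory Submission
  imports Defs
begin

text \<open>
  Write \<open>A = 1 + N\<close>. Then \<open>A\<close> is 1-nullcyclic if and only if every cycle, trivial or not, has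
  \<open>N\<close>-weight \<open>0\<close>. Every walk that visits some vertex twice contains a cycle, so its \<open>N\<close>-weight
  vanishes (\<open>walk_weight_not_distinct\<close>). In particular, this concerns closed walks with at least
  one edge, and all walks with at least \<open>n\<close> edges.

  Let \<open>I\<^sub>k(i, j)\<close> be an ideal that records the weights of the walks from \<open>i\<close> to \<open>j\<close> with at least
  \<open>k\<close> edges, and let \<open>J\<^sub>k\<close> be the set of the matrices whose \<open>(i, j)\<close> entries lie in \<open>I\<^sub>k(i, j)\<close>.
  Concatenation of walks gives \<open>J\<^sub>k J\<^sub>l \<subseteq> J\<^bsub>k+l\<^esub>\<close>, and the vanishing above gives \<open>J\<^sub>n = 0\<close> and
  \<open>I\<^sub>1(i, i) = 0\<close>. Hence \<open>1 + J\<^sub>1\<close> is a group under multiplication: the inverses exist because the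
  elements of \<open>J\<^sub>1\<close> are nilpotent (\<open>unipotent_inverse\<close>). This group contains \<open>A\<close> and
  therefore all its integer powers.

  Finally each matrix \<open>1 + M\<close> with \<open>M \<in> J\<^sub>1\<close> is 1-nullcyclic, because the \<open>M\<close>-weight of a cycle
  through \<open>i\<close> lies in \<open>I\<^sub>1(i, i) = 0\<close> (\<open>acyclic_mat_walk_mats\<close>).
\<close>

section \<open>Walks and their weights\<close>

fun walk_weight :: "'a::{comm_ring, comm_monoid_mult} mat \<Rightarrow> nat list \<Rightarrow> 'a" where
  "walk_weight M (x # y # ws) = M $$ (x, y) * walk_weight M (y # ws)"
| "walk_weight M _ = 1"

lemma walk_weight_append:
  "walk_weight M (xs @ y # zs) = walk_weight M (xs @ [y]) * walk_weight M (y # zs)"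
proof (induction xs)
  case (Cons a xs)
  then show ?case by (cases xs) (auto simp: mult.assoc)
qed simp

lemma walk_weight_conv_prod:
  "walk_weight M ws = (\<Prod>j<length ws - 1. M $$ (ws ! j, ws ! Suc j))"
  by (induction M ws rule: walk_weight.induct) (simp_all add: prod.lessThan_Suc_shift del: prod.lessThan_Suc)

lemma cycle_weight_Cons: "cycle_weight M (y # ys) = walk_weight M (y # ys @ [y])"
proof -
  have "(y # ys) ! (Suc j mod Suc (length ys)) = (ys @ [y]) ! j"
    and "(y # ys) ! j = (y # ys @ [y]) ! j" if "j < Suc (length ys)" for j
    using that by (auto simp: nth_append nth_Cons' mod_Suc)
  then show ?thesis
    unfolding cycle_weight_def walk_weight_conv_prod by (auto intro!: prod.cong)
qed

section \<open>Matrices all of whose cycle weights vanish\<close>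

definition acyclic_mat :: "nat \<Rightarrow> 'a::{comm_ring, comm_monoid_mult} mat \<Rightarrow> bool" where
  "acyclic_mat n M \<longleftrightarrow> M \<in> carrier_mat n n \<and> (\<forall>c. cycle_on n c \<longrightarrow> cycle_weight M c = 0)"

text \<open>
  The trivial cycles see the diagonal of \<open>M\<close>, while a nontrivial cycle never stays at a vertex
  and so does not notice the identity matrix.
\<close>

lemma one_nullcyclic_one_add_iff:
  fixes M :: "'a::{comm_ring, comm_monoid_mult} mat"
  assumes M: "M \<in> carrier_mat n n"
  shows "one_nullcyclic n (1\<^sub>m n + M) \<longleftrightarrow> acyclic_mat n M"
proof -
  have nontrivial: "cycle_weight (1\<^sub>m n + M) c = cycle_weight M c"
    if c: "nontrivial_cycle_on n c" for c
    unfolding cycle_weight_def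
  proof (rule prod.cong)
    fix j assume "j \<in> {..<length c}"
    then have "j < length c" by simp
    moreover from this have "Suc j mod length c < length c" by (intro mod_less_divisor) auto
    ultimately have j: "j < length c" "Suc j mod length c < length c" .
    have "Suc j mod length c \<noteq> j"
      using c j by (auto simp: nontrivial_cycle_on_def mod_Suc)
    then have "c ! j \<noteq> c ! (Suc j mod length c)"
      using c j by (auto simp: nontrivial_cycle_on_def cycle_on_def nth_eq_iff_index_eq)
    moreover have "c ! j < n" "c ! (Suc j mod length c) < n"
      using c j[THEN nth_mem] by (auto simp: nontrivial_cycle_on_def cycle_on_def simp del: nth_mem)
    ultimately show "(1\<^sub>m n + M) $$ (c ! j, c ! (Suc j mod length c))
        = M $$ (c ! j, c ! (Suc j mod length c))"
      using M by simp
  qed simp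
  have trivial: "(\<exists>i<n. c = [i]) \<or> nontrivial_cycle_on n c" if "cycle_on n c" for c
    using that by (cases c; cases "tl c") (auto simp: cycle_on_def nontrivial_cycle_on_def)
  have diagonal: "one_diagonal n (1\<^sub>m n + M) \<longleftrightarrow> (\<forall>i<n. cycle_weight M [i] = 0)"
    using M by (auto simp: one_diagonal_def cycle_weight_Cons)
  have loop: "cycle_on n [i]" if "i < n" for i
    using that by (simp add: cycle_on_def)
  have "nontrivial_cycle_on n c \<Longrightarrow> cycle_on n c" for c
    by (simp add: nontrivial_cycle_on_def)
  then show ?thesis
    using M nontrivial trivial loop
    unfolding one_nullcyclic_def acyclic_mat_def diagonal nullcyclic_def
    by (auto; metis)
qed

text \<open>
  Between two visits of the same vertex, the walk either is a cycle or repeats another vertex. In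
  the second case the walk can be replaced by that shorter part, since weights are multiplicative.
\<close>

lemma walk_weight_not_distinct:
  assumes N: "acyclic_mat n N"
  shows "set ws \<subseteq> {..<n} \<Longrightarrow> \<not> distinct ws \<Longrightarrow> walk_weight N ws = 0"
proof (induction ws rule: length_induct)
  case (1 ws)
  obtain xs y ys zs where ws: "ws = xs @ [y] @ ys @ [y] @ zs"
    using not_distinct_decomp[OF "1.prems"(2)] by blast
  have split: "walk_weight N ws =
      walk_weight N (xs @ [y]) * (walk_weight N (y # ys @ [y]) * walk_weight N (y # zs))"
    using walk_weight_append[of N xs y "ys @ y # zs"] walk_weight_append[of N "y # ys" y zs]
    by (simp add: ws)
  have "walk_weight N (y # ys @ [y]) = 0"
  proof (cases "distinct (y # ys)")
    case True
    then have "cycle_on n (y # ys)" using "1.prems"(1) by (auto simp: cycle_on_def ws)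
    then show ?thesis using N by (simp add: acyclic_mat_def flip: cycle_weight_Cons)
  next
    case False
    then have inner: "walk_weight N (y # ys) = 0"
      using "1.IH" "1.prems"(1) by (auto simp: ws)
    show ?thesis
    proof (cases ys rule: rev_cases)
      case Nil
      then show ?thesis using False by simp
    next
      case (snoc us u)
      then show ?thesis
        using inner walk_weight_append[of N "y # us" u "[y]"] by simp
    qed
  qed
  then show ?case by (simp add: split)
qed

section \<open>The ideals of walk weights\<close>

definition walk_on :: "nat \<Rightarrow> nat \<Rightarrow> nat \<Rightarrow> nat \<Rightarrow> nat list \<Rightarrow> bool" where
  "walk_on n k i j ws \<longleftrightarrow> set ws \<subseteq> {..<n} \<and> k < length ws \<and> hd ws = i \<and> last ws = j"

text \<open>
  This is the double annihilator of the weights of the walks from \<open>i\<close> to \<open>j\<close> with at least \<open>k\<close>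
  edges. It contains the ideal that they generate and vanishes as soon as they all do, and it is
  multiplicative along concatenation (\<open>walk_ideal_mult\<close>). These properties suffice, and none of
  them requires writing an element as a linear combination of weights.
\<close>

definition walk_ideal ::
    "nat \<Rightarrow> 'a::{comm_ring, comm_monoid_mult} mat \<Rightarrow> nat \<Rightarrow> nat \<Rightarrow> nat \<Rightarrow> 'a set" where
  "walk_ideal n N k i j =
     {x. \<forall>y. (\<forall>ws. walk_on n k i j ws \<longrightarrow> walk_weight N ws * y = 0) \<longrightarrow> x * y = 0}"

lemma walk_idealD:
  "x \<in> walk_ideal n N k i j \<Longrightarrow> (\<And>ws. walk_on n k i j ws \<Longrightarrow> walk_weight N ws * y = 0) \<Longrightarrow> x * y = 0"
  by (auto simp: walk_ideal_def)

lemma walk_ideal_zero: "0 \<in> walk_ideal n N k i j"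
  by (simp add: walk_ideal_def)

lemma walk_ideal_add:
  "x \<in> walk_ideal n N k i j \<Longrightarrow> y \<in> walk_ideal n N k i j \<Longrightarrow> x + y \<in> walk_ideal n N k i j"
  by (simp add: walk_ideal_def distrib_right)

lemma walk_ideal_uminus: "x \<in> walk_ideal n N k i j \<Longrightarrow> - x \<in> walk_ideal n N k i j"
  by (simp add: walk_ideal_def)

lemma walk_ideal_sum:
  "(\<And>a. a \<in> S \<Longrightarrow> f a \<in> walk_ideal n N k i j) \<Longrightarrow> sum f S \<in> walk_ideal n N k i j"
  by (induction S rule: infinite_finite_induct) (auto intro: walk_ideal_zero walk_ideal_add)

lemma walk_ideal_antimono: "k \<le> l \<Longrightarrow> walk_ideal n N l i j \<subseteq> walk_ideal n N k i j"
  by (auto simp: walk_ideal_def walk_on_def)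

lemma walk_on_append:
  assumes "walk_on n k i j ws" "walk_on n l j m vs"
  shows "walk_on n (k + l) i m (ws @ tl vs)"
    and "walk_weight N (ws @ tl vs) = walk_weight N ws * walk_weight N vs"
proof -
  obtain us where ws: "ws = us @ [j]"
    using assms(1) by (cases ws rule: rev_cases) (auto simp: walk_on_def)
  obtain ts where vs: "vs = j # ts"
    using assms(2) by (cases vs) (auto simp: walk_on_def)
  show "walk_on n (k + l) i m (ws @ tl vs)"
    using assms by (auto simp: walk_on_def ws vs hd_append)
  show "walk_weight N (ws @ tl vs) = walk_weight N ws * walk_weight N vs"
    using walk_weight_append[of N us j ts] by (simp add: ws vs)
qed

text \<open>
  Given \<open>y\<close> that annihilates the weights of all long walks from \<open>i\<close> to \<open>m\<close>, fix the first half
  of such a walk. Its weight times \<open>y\<close> annihilates the weights of all second halves, hence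
  annihilates \<open>z\<close>. So \<open>z * y\<close> annihilates the weights of all first halves, hence annihilates \<open>x\<close>.
\<close>

lemma walk_ideal_mult:
  assumes x: "x \<in> walk_ideal n N k i j" and z: "z \<in> walk_ideal n N l j m"
  shows "x * z \<in> walk_ideal n N (k + l) i m"
proof -
  have "x * z * y = 0"
    if y: "\<And>ws. walk_on n (k + l) i m ws \<Longrightarrow> walk_weight N ws * y = 0" for y
  proof -
    have "x * (z * y) = 0"
    proof (rule walk_idealD[OF x])
      fix ws assume ws: "walk_on n k i j ws"
      have "z * (walk_weight N ws * y) = 0"
      proof (rule walk_idealD[OF z])
        fix vs assume vs: "walk_on n l j m vs"
        show "walk_weight N vs * (walk_weight N ws * y) = 0"
          using y[OF walk_on_append(1)[OF ws vs]] walk_on_append(2)[OF ws vs, of N]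
          by (simp add: ac_simps)
      qed
      then show "walk_weight N ws * (z * y) = 0" by (simp add: ac_simps)
    qed
    then show ?thesis by (simp add: ac_simps)
  qed
  then show ?thesis by (auto simp: walk_ideal_def)
qed

lemma walk_ideal_edge: "i < n \<Longrightarrow> j < n \<Longrightarrow> N $$ (i, j) \<in> walk_ideal n N 1 i j"
  by (auto simp: walk_ideal_def walk_on_def dest: spec[of _ "[i, j]"])

lemma walk_ideal_eq_zero:
  assumes "\<And>ws. walk_on n k i j ws \<Longrightarrow> walk_weight N ws = 0"
    and "x \<in> walk_ideal n N k i j"
  shows "x = 0"
  using walk_idealD[OF assms(2), of 1] assms(1) by simp

lemma walk_ideal_closed_eq_zero:
  assumes N: "acyclic_mat n N" and x: "x \<in> walk_ideal n N 1 i i"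
  shows "x = 0"
proof (rule walk_ideal_eq_zero[OF _ x])
  fix ws assume ws: "walk_on n 1 i i ws"
  then have "\<not> distinct ws"
    by (cases ws; cases "tl ws" rule: rev_cases) (auto simp: walk_on_def)
  then show "walk_weight N ws = 0"
    using walk_weight_not_distinct[OF N] ws by (auto simp: walk_on_def)
qed

text \<open>A walk with \<open>n\<close> edges has \<open>n + 1\<close> vertices, so the pigeonhole principle applies.\<close>

lemma walk_ideal_long_eq_zero:
  assumes N: "acyclic_mat n N" and x: "x \<in> walk_ideal n N n i j"
  shows "x = 0"
proof (rule walk_ideal_eq_zero[OF _ x])
  fix ws assume ws: "walk_on n n i j ws"
  then have "card (set ws) \<le> n"
    using card_mono[of "{..<n}" "set ws"] by (simp add: walk_on_def)
  then have "\<not> distinct ws"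
    using ws distinct_card[of ws] by (auto simp: walk_on_def)
  then show "walk_weight N ws = 0"
    using walk_weight_not_distinct[OF N] ws by (auto simp: walk_on_def)
qed

section \<open>The filtration of matrices by walk length\<close>

definition walk_mats :: "nat \<Rightarrow> 'a::{comm_ring, comm_monoid_mult} mat \<Rightarrow> nat \<Rightarrow> 'a mat set" where
  "walk_mats n N k =
     {M \<in> carrier_mat n n. \<forall>i<n. \<forall>j<n. M $$ (i, j) \<in> walk_ideal n N k i j}"

lemma walk_mats_carrier: "M \<in> walk_mats n N k \<Longrightarrow> M \<in> carrier_mat n n"
  by (simp add: walk_mats_def)

lemma walk_mats_self: "N \<in> carrier_mat n n \<Longrightarrow> N \<in> walk_mats n N 1"
  using walk_ideal_edge by (auto simp: walk_mats_def)

lemma walk_mats_zero: "0\<^sub>m n n \<in> walk_mats n N k"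
  by (auto simp: walk_mats_def walk_ideal_zero)

lemma walk_mats_add: "M \<in> walk_mats n N k \<Longrightarrow> P \<in> walk_mats n N k \<Longrightarrow> M + P \<in> walk_mats n N k"
  by (auto simp: walk_mats_def walk_ideal_add)

lemma walk_mats_uminus: "M \<in> walk_mats n N k \<Longrightarrow> - M \<in> walk_mats n N k"
  by (auto simp: walk_mats_def walk_ideal_uminus)

lemma walk_mats_antimono: "k \<le> l \<Longrightarrow> walk_mats n N l \<subseteq> walk_mats n N k"
  using walk_ideal_antimono by (fastforce simp: walk_mats_def)

lemma walk_mats_mult:
  assumes "M \<in> walk_mats n N k" "P \<in> walk_mats n N l"
  shows "M * P \<in> walk_mats n N (k + l)"
proof -
  have "(M * P) $$ (i, j) \<in> walk_ideal n N (k + l) i j" if ij: "i < n" "j < n" for i j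
  proof -
    have "(M * P) $$ (i, j) = (\<Sum>a\<in>{0..<n}. M $$ (i, a) * P $$ (a, j))"
      using assms ij by (auto simp: walk_mats_def scalar_prod_def)
    also have "\<dots> \<in> walk_ideal n N (k + l) i j"
    proof (rule walk_ideal_sum)
      fix a assume "a \<in> {0..<n}"
      then show "M $$ (i, a) * P $$ (a, j) \<in> walk_ideal n N (k + l) i j"
        using assms ij by (intro walk_ideal_mult[where j = a]) (auto simp: walk_mats_def)
    qed
    finally show ?thesis .
  qed
  then show ?thesis using assms by (auto simp: walk_mats_def)
qed

lemma walk_mats_long_eq_zero:
  assumes "acyclic_mat n N" "M \<in> walk_mats n N n"
  shows "M = 0\<^sub>m n n"
  using assms walk_ideal_long_eq_zero by (intro eq_matI) (fastforce simp: walk_mats_def)+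

lemma walk_weight_walk_mats:
  assumes M: "M \<in> walk_mats n N 1"
  shows "set (x # y # ws) \<subseteq> {..<n} \<Longrightarrow>
    walk_weight M (x # y # ws) \<in> walk_ideal n N 1 x (last (y # ws))"
proof (induction ws arbitrary: x y)
  case Nil
  then show ?case using M by (simp add: walk_mats_def)
next
  case (Cons z ws)
  have "M $$ (x, y) \<in> walk_ideal n N 1 x y"
    using M Cons.prems by (simp add: walk_mats_def)
  moreover have "walk_weight M (y # z # ws) \<in> walk_ideal n N 1 y (last (z # ws))"
    using Cons by simp
  ultimately have "M $$ (x, y) * walk_weight M (y # z # ws)
      \<in> walk_ideal n N (1 + 1) x (last (z # ws))"
    by (rule walk_ideal_mult)
  then have "M $$ (x, y) * walk_weight M (y # z # ws) \<in> walk_ideal n N 1 x (last (z # ws))"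
    by (rule subsetD[OF walk_ideal_antimono, rotated]) simp
  then show ?case by simp
qed

lemma acyclic_mat_walk_mats:
  assumes N: "acyclic_mat n N" and M: "M \<in> walk_mats n N 1"
  shows "acyclic_mat n M"
proof -
  have "cycle_weight M c = 0" if c: "cycle_on n c" for c
  proof -
    obtain y ys where ys: "c = y # ys" using c by (cases c) (auto simp: cycle_on_def)
    obtain z zs where zs: "ys @ [y] = z # zs" by (cases "ys @ [y]") auto
    have "set (y # ys @ [y]) \<subseteq> {..<n}" using c by (auto simp: cycle_on_def ys)
    then have "walk_weight M (y # ys @ [y]) \<in> walk_ideal n N 1 y (last (ys @ [y]))"
      using walk_weight_walk_mats[OF M, of y z zs] by (simp only: zs)
    then show ?thesis
      using walk_ideal_closed_eq_zero[OF N] by (simp add: ys cycle_weight_Cons)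
  qed
  then show ?thesis using M by (simp add: acyclic_mat_def walk_mats_carrier)
qed

section \<open>The group of the matrices congruent to the identity\<close>

text \<open>
  The class of the entries admits the zero ring, so the unit laws are read off the monoid of
  matrices.
\<close>

lemma mat_one_mult:
  fixes M :: "'a::{comm_ring, comm_monoid_mult} mat"
  assumes "M \<in> carrier_mat n n"
  shows "1\<^sub>m n * M = M" and "M * 1\<^sub>m n = M"
  using monoid.l_one[OF monoid_mat_monoid[where 'a = 'a], of M n]
    monoid.r_one[OF monoid_mat_monoid[where 'a = 'a], of M n] assms
  by (simp_all add: mat_monoid_def)

definition unipotents :: "nat \<Rightarrow> 'a::{comm_ring, comm_monoid_mult} mat \<Rightarrow> 'a mat set" where
  "unipotents n N = (\<lambda>M. 1\<^sub>m n + M) ` walk_mats n N 1"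

lemma unipotents_carrier: "B \<in> unipotents n N \<Longrightarrow> B \<in> carrier_mat n n"
  by (auto simp: unipotents_def dest: walk_mats_carrier)

lemma one_mat_unipotents: "1\<^sub>m n \<in> unipotents n N"
  unfolding unipotents_def by (rule image_eqI[OF _ walk_mats_zero]) simp

lemma one_add_mult_one_add:
  fixes M :: "'a::{comm_ring, comm_monoid_mult} mat"
  assumes M: "M \<in> carrier_mat n n" and P: "P \<in> carrier_mat n n"
  shows "(1\<^sub>m n + M) * (1\<^sub>m n + P) = 1\<^sub>m n + (M + (P + M * P))"
proof -
  have "(1\<^sub>m n + M) * (1\<^sub>m n + P) = (1\<^sub>m n + P) + (M + M * P)"
    using M P add_mult_distrib_mat[of "1\<^sub>m n" n n M "1\<^sub>m n + P" n]
      mult_add_distrib_mat[of M n n "1\<^sub>m n" n P]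
    by (simp add: mat_one_mult)
  also have "\<dots> = 1\<^sub>m n + (M + (P + M * P))"
    using M P by (intro eq_matI) (auto simp: ac_simps)
  finally show ?thesis .
qed

lemma unipotents_mult:
  assumes "B \<in> unipotents n N" "C \<in> unipotents n N"
  shows "B * C \<in> unipotents n N"
proof -
  obtain M P where M: "M \<in> walk_mats n N 1" "B = 1\<^sub>m n + M" and P: "P \<in> walk_mats n N 1" "C = 1\<^sub>m n + P"
    using assms by (auto simp: unipotents_def)
  have "M * P \<in> walk_mats n N 1"
    using subsetD[OF walk_mats_antimono walk_mats_mult[OF M(1) P(1)]] by simp
  then have "M + (P + M * P) \<in> walk_mats n N 1"
    using M P by (intro walk_mats_add)
  then show ?thesis
    using M P by (auto simp: unipotents_def one_add_mult_one_add walk_mats_carrier)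
qed

text \<open>
  Since \<open>(1 + M) (1 - M) = (1 - M) (1 + M) = 1 - M\<^sup>2\<close>, an inverse of \<open>1 - M\<^sup>2\<close> yields one of
  \<open>1 + M\<close>. As \<open>M\<^sup>2\<close> lies deeper in the filtration, which reaches \<open>0\<close> at step \<open>n\<close>, the claim
  follows by induction on the number of remaining steps. This avoids summing a geometric series.
\<close>

lemma unipotent_inverse_aux:
  fixes N :: "'a::{comm_ring, comm_monoid_mult} mat"
  assumes N: "acyclic_mat n N"
  shows "1 \<le> k \<Longrightarrow> M \<in> walk_mats n N k \<Longrightarrow>
    \<exists>C\<in>unipotents n N. C * (1\<^sub>m n + M) = 1\<^sub>m n \<and> (1\<^sub>m n + M) * C = 1\<^sub>m n"
proof (induction "n - k" arbitrary: k M rule: less_induct)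
  case less
  show ?case
  proof (cases "n \<le> k")
    case True
    then have "M \<in> walk_mats n N n"
      using subsetD[OF walk_mats_antimono less.prems(2)] by simp
    then have "M = 0\<^sub>m n n" by (rule walk_mats_long_eq_zero[OF N])
    then show ?thesis
      using one_mat_unipotents[of n N] by (intro bexI[of _ "1\<^sub>m n"]) (auto simp: mat_one_mult)
  next
    case False
    let ?B = "1\<^sub>m n + M" and ?D = "1\<^sub>m n + - M" and ?E = "1\<^sub>m n + - (M * M)"
    have M: "M \<in> carrier_mat n n" using less.prems by (simp add: walk_mats_carrier)
    have "M * M \<in> walk_mats n N (Suc k)"
      using subsetD[OF walk_mats_antimono walk_mats_mult[OF less.prems(2,2)]] less.prems(1) by simp
    then have "- (M * M) \<in> walk_mats n N (Suc k)" by (rule walk_mats_uminus)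
    moreover have "n - Suc k < n - k" "1 \<le> Suc k" using False by auto
    ultimately obtain C where C: "C \<in> unipotents n N" "C * ?E = 1\<^sub>m n" "?E * C = 1\<^sub>m n"
      using less.hyps by blast
    have D: "?D \<in> unipotents n N"
      using walk_mats_uminus[OF subsetD[OF walk_mats_antimono less.prems(2)]] less.prems(1)
      by (simp add: unipotents_def)
    have c: "C \<in> carrier_mat n n" "?D \<in> carrier_mat n n" "?B \<in> carrier_mat n n"
      using C(1) M by (auto simp: unipotents_carrier)
    have MM: "- M * M = - (M * M)" "M * - M = - (M * M)"
      using M by simp_all
    have BD: "?B * ?D = ?E"
      using M by (subst one_add_mult_one_add) (auto simp: MM intro!: eq_matI)
    have DB: "?D * ?B = ?E"
      using M by (subst one_add_mult_one_add) (auto simp: MM intro!: eq_matI)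
    have left: "(C * ?D) * ?B = 1\<^sub>m n"
      using C(2) DB assoc_mult_mat[OF c(1,2,3)] by simp
    have right: "?B * (?D * C) = 1\<^sub>m n"
      using C(3) BD assoc_mult_mat[OF c(3,2,1)] by simp
    \<comment> \<open>A left and a right inverse of the same element of a monoid agree.\<close>
    have "C * ?D = (C * ?D) * (?B * (?D * C))"
      using c by (simp only: right) (simp add: mat_one_mult)
    also have "\<dots> = ((C * ?D) * ?B) * (?D * C)"
      using c by (intro assoc_mult_mat[symmetric] mult_carrier_mat)
    also have "\<dots> = ?D * C"
      using c by (simp only: left) (simp add: mat_one_mult)
    finally have "?B * (C * ?D) = 1\<^sub>m n" using right by simp
    then show ?thesis using left unipotents_mult[OF C(1) D] by blast
  qed
qed

lemma unipotent_inverse: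
  assumes "acyclic_mat n N" "B \<in> unipotents n N"
  obtains C where "C \<in> unipotents n N" "C * B = 1\<^sub>m n" "B * C = 1\<^sub>m n"
  using assms unipotent_inverse_aux[OF assms(1), of 1] by (auto simp: unipotents_def)

lemma unipotents_int_pow:
  fixes N :: "'a::{comm_ring, comm_monoid_mult} mat"
  assumes N: "acyclic_mat n N" and B: "B \<in> unipotents n N"
  shows "B \<in> Units (mat_monoid TYPE('a) n)"
    and "B [^]\<^bsub>mat_monoid TYPE('a) n\<^esub> (m::int) \<in> unipotents n N"
proof -
  let ?G = "mat_monoid TYPE('a) n"
  interpret monoid ?G by (rule monoid_mat_monoid)
  have G: "carrier ?G = carrier_mat n n" "\<And>X Y. X \<otimes>\<^bsub>?G\<^esub> Y = X * Y" "\<one>\<^bsub>?G\<^esub> = 1\<^sub>m n"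
    by (simp_all add: mat_monoid_def)
  have inverse: "X \<in> Units ?G \<and> inv\<^bsub>?G\<^esub> X \<in> unipotents n N" if X: "X \<in> unipotents n N" for X
  proof -
    obtain C where C: "C \<in> unipotents n N" "C * X = 1\<^sub>m n" "X * C = 1\<^sub>m n"
      using unipotent_inverse[OF N X] .
    then have "inv\<^bsub>?G\<^esub> X = C"
      using X by (intro inv_unique'[symmetric]) (auto simp: G unipotents_carrier)
    moreover have "X \<in> Units ?G"
      using C X by (auto simp: Units_def G unipotents_carrier)
    ultimately show ?thesis using C(1) by simp
  qed
  show "B \<in> Units ?G" using inverse[OF B] by simp
  have nat_pow: "B [^]\<^bsub>?G\<^esub> (k::nat) \<in> unipotents n N" for k
    by (induction k) (auto simp: G one_mat_unipotents unipotents_mult B)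
  show "B [^]\<^bsub>?G\<^esub> m \<in> unipotents n N"
    using nat_pow conjunct2[OF inverse[OF nat_pow]] by (simp only: int_pow_def2 split: if_split) blast
qed

theorem proposition3p5:
  fixes A :: "'a::{comm_ring, comm_monoid_mult} mat" and n :: nat and m :: int
  assumes "one_nullcyclic n A"
  shows "A \<in> Units (mat_monoid TYPE('a) n) \<and>
         one_nullcyclic n (A [^]\<^bsub>mat_monoid TYPE('a) n\<^esub> m)"
proof -
  define N where "N = A - 1\<^sub>m n"
  have A: "A \<in> carrier_mat n n" using assms by (simp add: one_nullcyclic_def)
  then have c: "N \<in> carrier_mat n n" by (auto simp: N_def)
  have AN: "A = 1\<^sub>m n + N" using A by (intro eq_matI) (auto simp: N_def)
  have N: "acyclic_mat n N"
    using assms c by (simp add: AN one_nullcyclic_one_add_iff)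
  have unipotent: "A \<in> unipotents n N"
    using walk_mats_self[OF c] by (simp add: AN unipotents_def)
  obtain M where M: "M \<in> walk_mats n N 1" "A [^]\<^bsub>mat_monoid TYPE('a) n\<^esub> m = 1\<^sub>m n + M"
    using unipotents_int_pow(2)[OF N unipotent, of m] by (auto simp: unipotents_def)
  then have "one_nullcyclic n (A [^]\<^bsub>mat_monoid TYPE('a) n\<^esub> m)"
    using acyclic_mat_walk_mats[OF N] by (simp add: one_nullcyclic_one_add_iff walk_mats_carrier)
  then show ?thesis using unipotents_int_pow(1)[OF N unipotent] by simp
qed

end
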